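(* Let $\Omega\subset\mathbb{C}^n$ be a domain (not assumed bounded) and let $1<p<2$. Suppose there exist a bounded linear operator $\mathbf{P}:L^2(\Omega)\to A^2(\Omega)$ given by an integral formula $\mathbf{P}f(z)=\int_\Omega P(z,w)f(w)\,dV(w)$ and a set $\mathcal{G}\subseteq A^p(\Omega)$ such that (i) $\mathbf{P}$ is bounded on $L^p(\Omega)$; (ii) $\mathbf{P}h=h$ for all $h\in\mathcal{G}$. Then every $f\in\mathcal{G}$ can be approximated in the $L^p$ norm by a sequence $f_n\in A^2(\Omega)$.
   Context: $dV$ is Lebesgue measure; $A^p(\Omega)$ is the Bergman space of holomorphic functions on $\Omega$ lying in $L^p(\Omega)$. On $L^p(\Omega)$ the operator $\mathbf{P}$ is defined by the same integral formula; bounded on $L^p(\Omega)$ means there is $C>0$ with $\|\mathbf{P}f\|_p\le C\|f\|_p$ for all $f\in L^p(\Omega)$. *)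

theory Defs
  imports "HOL-Analysis.Analysis"
begin

definition holo_on :: "(complex ^ 'n \<Rightarrow> complex) \<Rightarrow> (complex ^ 'n) set \<Rightarrow> bool" where
  "holo_on f \<Omega> \<longleftrightarrow>
     (\<forall>z\<in>\<Omega>. \<exists>D. (f has_derivative D) (at z) \<and> (\<forall>c v. D (c *s v) = c * D v))"

text \<open>
  Elements of \<open>L\<^sup>q(\<Omega>)\<close> are represented by functions, of which only the restriction to \<open>\<Omega>\<close>
  matters; equality in \<open>L\<^sup>q(\<Omega>)\<close> is equality almost everywhere on \<open>\<Omega>\<close>. Since the Bochner
  integral of a non-integrable function is 0, \<open>Lp_norm\<close> is meaningful only on \<open>Lp\<close>.
\<close>

definition Lp :: "(complex ^ 'n) set \<Rightarrow> real \<Rightarrow> (complex ^ 'n \<Rightarrow> complex) set" where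
  "Lp \<Omega> q = {f. f \<in> borel_measurable (lebesgue_on \<Omega>) \<and>
                 integrable (lebesgue_on \<Omega>) (\<lambda>z. norm (f z) powr q)}"

definition Lp_norm :: "(complex ^ 'n) set \<Rightarrow> real \<Rightarrow> (complex ^ 'n \<Rightarrow> complex) \<Rightarrow> real" where
  "Lp_norm \<Omega> q f = (LINT z|lebesgue_on \<Omega>. norm (f z) powr q) powr (1 / q)"

definition bergman :: "(complex ^ 'n) set \<Rightarrow> real \<Rightarrow> (complex ^ 'n \<Rightarrow> complex) set" where
  "bergman \<Omega> q = {f \<in> Lp \<Omega> q. holo_on f \<Omega>}"

definition Lp_linear ::
  "(complex ^ 'n) set \<Rightarrow> real \<Rightarrow> ((complex ^ 'n \<Rightarrow> complex) \<Rightarrow> (complex ^ 'n \<Rightarrow> complex)) \<Rightarrow> bool" where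
  "Lp_linear \<Omega> q P \<longleftrightarrow>
     (\<forall>f\<in>Lp \<Omega> q. \<forall>g\<in>Lp \<Omega> q.
        AE z in lebesgue_on \<Omega>. P (\<lambda>w. f w + g w) z = P f z + P g z) \<and>
     (\<forall>c. \<forall>f\<in>Lp \<Omega> q. AE z in lebesgue_on \<Omega>. P (\<lambda>w. c * f w) z = c * P f z)"

definition Lp_bounded ::
  "(complex ^ 'n) set \<Rightarrow> real \<Rightarrow> ((complex ^ 'n \<Rightarrow> complex) \<Rightarrow> (complex ^ 'n \<Rightarrow> complex)) \<Rightarrow> bool" where
  "Lp_bounded \<Omega> q P \<longleftrightarrow>
     (\<exists>C>0. \<forall>f\<in>Lp \<Omega> q. P f \<in> Lp \<Omega> q \<and> Lp_norm \<Omega> q (P f) \<le> C * Lp_norm \<Omega> q f)"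

text \<open>
  The integral formula includes absolute convergence of the integral. It is required for almost
  every \<open>z\<close>, as usual for operators on \<open>L\<^sup>q(\<Omega>)\<close>.
\<close>

definition given_by_kernel ::
  "(complex ^ 'n) set \<Rightarrow> real \<Rightarrow> (complex ^ 'n \<Rightarrow> complex ^ 'n \<Rightarrow> complex) \<Rightarrow>
   ((complex ^ 'n \<Rightarrow> complex) \<Rightarrow> (complex ^ 'n \<Rightarrow> complex)) \<Rightarrow> bool" where
  "given_by_kernel \<Omega> q K P \<longleftrightarrow>
     (\<forall>f\<in>Lp \<Omega> q. AE z in lebesgue_on \<Omega>.
        integrable (lebesgue_on \<Omega>) (\<lambda>w. K z w * f w) \<and>
        P f z = (LINT w|lebesgue_on \<Omega>. K z w * f w))"

end

(* The truncations f 1_{|f| \<le> n} lie in L^2 because |f|^2 \<le> n^{2-p} |f|^p where |f| \<le> n, and they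
   converge to f in L^p by dominated convergence. Hence their images under P lie in A^2 and, as
   P is bounded on L^p, they converge to P f = f in L^p. *)

theory Submission
  imports Defs
begin

text \<open>Values above the threshold become 0 instead of being scaled down to norm
  \<open>r\<close>, so that \<open>truncate r f z - f z\<close> is always either 0 or
  \<open>- f z\<close>.\<close>

definition truncate :: "real \<Rightarrow> ('a \<Rightarrow> 'b::real_normed_vector) \<Rightarrow> 'a \<Rightarrow> 'b" where
  "truncate r f z = (if norm (f z) \<le> r then f z else 0)"

lemma truncate_measurable [measurable]:
  fixes f :: "'a \<Rightarrow> complex"
  assumes [measurable]: "f \<in> borel_measurable M"
  shows "truncate r f \<in> borel_measurable M"
  unfolding truncate_def by measurable

lemma norm_truncate_diff_le: "norm (truncate r f z - f z) \<le> norm (f z)"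
  by (simp add: truncate_def)

lemma Lp_dominated:
  assumes g: "g \<in> Lp \<Omega> q" and q: "0 \<le> q"
    and f [measurable]: "f \<in> borel_measurable (lebesgue_on \<Omega>)"
    and le: "\<And>z. norm (f z) \<le> norm (g z)"
  shows "f \<in> Lp \<Omega> q"
proof -
  have "integrable (lebesgue_on \<Omega>) (\<lambda>z. norm (f z) powr q)"
    by (rule Bochner_Integration.integrable_bound[of _ "\<lambda>z. norm (g z) powr q"])
      (use g q le in \<open>auto simp: Lp_def intro!: powr_mono2\<close>)
  then show ?thesis
    by (simp add: Lp_def f)
qed

text \<open>The kernel formula and the fixed-point property hold only almost everywhere; this
  carries membership and norm from \<open>P (d n)\<close> over to \<open>P (t n) - f\<close> in the
  final argument.\<close>

lemma
  assumes g: "g \<in> Lp \<Omega> q"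
    and f [measurable]: "f \<in> borel_measurable (lebesgue_on \<Omega>)"
    and eq: "AE z in lebesgue_on \<Omega>. f z = g z"
  shows Lp_cong_AE: "f \<in> Lp \<Omega> q"
    and Lp_norm_cong_AE: "Lp_norm \<Omega> q f = Lp_norm \<Omega> q g"
proof -
  have [measurable]: "g \<in> borel_measurable (lebesgue_on \<Omega>)"
    using g by (simp add: Lp_def)
  have ae: "AE z in lebesgue_on \<Omega>. norm (f z) powr q = norm (g z) powr q"
    using eq by eventually_elim simp
  have "integrable (lebesgue_on \<Omega>) (\<lambda>z. norm (f z) powr q)
      \<longleftrightarrow> integrable (lebesgue_on \<Omega>) (\<lambda>z. norm (g z) powr q)"
    by (rule integrable_cong_AE[OF _ _ ae]) measurable
  then show "f \<in> Lp \<Omega> q"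
    using g by (simp add: Lp_def)
  have "(LINT z|lebesgue_on \<Omega>. norm (f z) powr q) = (LINT z|lebesgue_on \<Omega>. norm (g z) powr q)"
    by (rule integral_cong_AE[OF _ _ ae]) measurable
  then show "Lp_norm \<Omega> q f = Lp_norm \<Omega> q g"
    by (simp add: Lp_norm_def)
qed

text \<open>The exponent \<open>q = p\<close> is included, so that one lemma puts the truncations
  both in L^2 and in L^p.\<close>

lemma truncate_in_higher_Lp:
  assumes f: "f \<in> Lp \<Omega> p" and p: "0 \<le> p" "p \<le> q" and r: "0 \<le> r"
  shows "truncate r f \<in> Lp \<Omega> q"
proof -
  have [measurable]: "f \<in> borel_measurable (lebesgue_on \<Omega>)"
    and int: "integrable (lebesgue_on \<Omega>) (\<lambda>z. norm (f z) powr p)"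
    using f by (auto simp: Lp_def)
  have le: "norm (truncate r f z) powr q \<le> r powr (q - p) * norm (f z) powr p" for z
  proof (cases "norm (f z) \<le> r")
    case True
    \<comment> \<open>This also holds where \<open>f z = 0\<close>, because
      \<open>0 powr a = 0\<close> for every \<open>a\<close>, even for \<open>a = 0\<close>.\<close>
    have "norm (f z) powr q = norm (f z) powr (q - p) * norm (f z) powr p"
      by (simp flip: powr_add)
    also have "\<dots> \<le> r powr (q - p) * norm (f z) powr p"
      by (intro mult_right_mono powr_mono2) (use True p in auto)
    finally show ?thesis
      using True by (simp add: truncate_def)
  qed (simp add: truncate_def)
  have "integrable (lebesgue_on \<Omega>) (\<lambda>z. norm (truncate r f z) powr q)"
    by (rule Bochner_Integration.integrable_bound
        [of _ "\<lambda>z. r powr (q - p) * norm (f z) powr p"]) (use int le in auto)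
  then show ?thesis
    by (simp add: Lp_def truncate_measurable)
qed

lemma Lp_norm_truncate_tendsto:
  assumes f: "f \<in> Lp \<Omega> p" and p: "0 < p"
  shows "(\<lambda>n. Lp_norm \<Omega> p (\<lambda>z. truncate (real n) f z - f z)) \<longlonglongrightarrow> 0"
proof -
  have [measurable]: "f \<in> borel_measurable (lebesgue_on \<Omega>)"
    and int: "integrable (lebesgue_on \<Omega>) (\<lambda>z. norm (f z) powr p)"
    using f by (auto simp: Lp_def)
  \<comment> \<open>At a fixed point the sequence is exactly 0 as soon as \<open>n\<close> reaches
    \<open>norm (f z)\<close>.\<close>
  have lim: "(\<lambda>n. norm (truncate (real n) f z - f z) powr p) \<longlonglongrightarrow> 0" for z
  proof (rule tendsto_eventually)
    obtain N where "norm (f z) \<le> real N"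
      using real_arch_simple by blast
    then show "\<forall>\<^sub>F n in sequentially. norm (truncate (real n) f z - f z) powr p = 0"
      by (auto simp: truncate_def eventually_sequentially intro!: exI[of _ N])
  qed
  have "(\<lambda>n. LINT z|lebesgue_on \<Omega>. norm (truncate (real n) f z - f z) powr p)
      \<longlonglongrightarrow> (LINT z|lebesgue_on \<Omega>. 0)"
    by (rule integral_dominated_convergence[where w = "\<lambda>z. norm (f z) powr p"])
      (use int lim p in \<open>auto intro!: powr_mono2 norm_truncate_diff_le\<close>)
  \<comment> \<open>The base tends to 0, where continuity of the power relies on the integrals being
    nonnegative and on \<open>1 / p > 0\<close>.\<close>
  then have "(\<lambda>n. (LINT z|lebesgue_on \<Omega>. norm (truncate (real n) f z - f z) powr p) powr (1 / p))
      \<longlonglongrightarrow> 0 powr (1 / p)"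
    by (intro tendsto_powr2) (use p in auto)
  then show ?thesis
    by (simp add: Lp_norm_def)
qed

text \<open>Absolute convergence for \<open>f\<close> and for \<open>g\<close> allows the integral
  of the difference to be split. The lemma is applied with exponent \<open>p\<close> to
  \<open>t n\<close> and \<open>f\<close>, where \<open>f\<close> may lie outside L^2.\<close>

lemma given_by_kernel_diff:
  assumes "given_by_kernel \<Omega> q K P"
    and "f \<in> Lp \<Omega> q" "g \<in> Lp \<Omega> q" "(\<lambda>z. f z - g z) \<in> Lp \<Omega> q"
  shows "AE z in lebesgue_on \<Omega>. P (\<lambda>z. f z - g z) z = P f z - P g z"
proof -
  have *: "AE z in lebesgue_on \<Omega>. integrable (lebesgue_on \<Omega>) (\<lambda>w. K z w * h w) \<and>
      P h z = (LINT w|lebesgue_on \<Omega>. K z w * h w)" if "h \<in> Lp \<Omega> q" for h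
    using assms(1) that by (auto simp: given_by_kernel_def)
  show ?thesis
    using *[OF assms(2)] *[OF assms(3)] *[OF assms(4)]
    by eventually_elim (simp add: right_diff_distrib)
qed

theorem theorem2p18:
  fixes \<Omega> :: "(complex ^ 'n) set"
    and p :: real
    and K :: "complex ^ 'n \<Rightarrow> complex ^ 'n \<Rightarrow> complex"
    and P :: "(complex ^ 'n \<Rightarrow> complex) \<Rightarrow> (complex ^ 'n \<Rightarrow> complex)"
    and G :: "(complex ^ 'n \<Rightarrow> complex) set"
  assumes domain: "open \<Omega>" "connected \<Omega>" "\<Omega> \<noteq> {}"
    and p: "1 < p" "p < 2"
    and P_L2: "\<forall>f\<in>Lp \<Omega> 2. P f \<in> bergman \<Omega> 2" "Lp_linear \<Omega> 2 P" "Lp_bounded \<Omega> 2 P"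
    and kernel_L2: "given_by_kernel \<Omega> 2 K P"
    and kernel_Lp: "given_by_kernel \<Omega> p K P"
    and G: "G \<subseteq> bergman \<Omega> p"
    and P_Lp: "Lp_bounded \<Omega> p P"
    and P_fix: "\<forall>h\<in>G. AE z in lebesgue_on \<Omega>. P h z = h z"
  shows "\<forall>f\<in>G. \<exists>F :: nat \<Rightarrow> complex ^ 'n \<Rightarrow> complex.
           (\<forall>n. F n \<in> bergman \<Omega> 2 \<and> (\<lambda>z. F n z - f z) \<in> Lp \<Omega> p) \<and>
           (\<lambda>n. Lp_norm \<Omega> p (\<lambda>z. F n z - f z)) \<longlonglongrightarrow> 0"
proof
  fix f assume "f \<in> G"
  then have f: "f \<in> Lp \<Omega> p" and Pf: "AE z in lebesgue_on \<Omega>. P f z = f z"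
    using G P_fix by (auto simp: bergman_def)
  then have [measurable]: "f \<in> borel_measurable (lebesgue_on \<Omega>)"
    by (simp add: Lp_def)
  obtain C where C: "\<And>h. h \<in> Lp \<Omega> p \<Longrightarrow> P h \<in> Lp \<Omega> p"
    "\<And>h. h \<in> Lp \<Omega> p \<Longrightarrow> Lp_norm \<Omega> p (P h) \<le> C * Lp_norm \<Omega> p h"
    using P_Lp by (auto simp: Lp_bounded_def)
  define t where "t n = truncate (real n) f" for n
  define d where "d n = (\<lambda>z. t n z - f z)" for n
  have t_meas [measurable]: "t n \<in> borel_measurable (lebesgue_on \<Omega>)" for n
    unfolding t_def by measurable
  have t_p: "t n \<in> Lp \<Omega> p" and t_2: "t n \<in> Lp \<Omega> 2" for n
    using truncate_in_higher_Lp[OF f] p by (auto simp: t_def)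
  \<comment> \<open>Pointwise \<open>d n\<close> is 0 or \<open>- f\<close>, hence dominated by
    \<open>f\<close>.\<close>
  have d_p: "d n \<in> Lp \<Omega> p" for n
    unfolding d_def
    by (rule Lp_dominated[OF f]) (use p in \<open>simp_all add: t_def norm_truncate_diff_le\<close>)
  \<comment> \<open>The reproducing property enters here: P(t_n) - f = P(t_n) - P(f) = P(t_n - f)
    almost everywhere.\<close>
  have eq: "AE z in lebesgue_on \<Omega>. P (t n) z - f z = P (d n) z" for n
    using given_by_kernel_diff[OF kernel_Lp t_p[of n] f d_p[unfolded d_def]] Pf
    unfolding d_def by eventually_elim simp
  have P_meas: "(\<lambda>z. P (t n) z - f z) \<in> borel_measurable (lebesgue_on \<Omega>)" for n
    using C(1)[OF t_p[of n]] by (auto simp: Lp_def)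
  have "(\<lambda>n. C * Lp_norm \<Omega> p (d n)) \<longlonglongrightarrow> 0"
    using tendsto_mult_right_zero[OF Lp_norm_truncate_tendsto[OF f]] p by (simp add: d_def t_def)
  \<comment> \<open>Squeezed between 0 and \<open>C\<close> times the norm of \<open>d n\<close>, by
    boundedness on L^p.\<close>
  then have "(\<lambda>n. Lp_norm \<Omega> p (P (d n))) \<longlonglongrightarrow> 0"
    by (rule Lim_null_comparison[rotated]) (use C(2) d_p in \<open>auto simp: Lp_norm_def\<close>)
  then have "(\<lambda>n. Lp_norm \<Omega> p (\<lambda>z. P (t n) z - f z)) \<longlonglongrightarrow> 0"
    using Lp_norm_cong_AE[OF C(1)[OF d_p] P_meas eq] by simp
  \<comment> \<open>Both scales meet in \<open>P (t n)\<close>: it lies in A^2 because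
    \<open>t n\<close> is in L^2, while its distance to \<open>f\<close> is measured in L^p through
    \<open>P (d n)\<close>.\<close>
  moreover have "P (t n) \<in> bergman \<Omega> 2 \<and> (\<lambda>z. P (t n) z - f z) \<in> Lp \<Omega> p" for n
    using P_L2(1) t_2 Lp_cong_AE[OF C(1)[OF d_p] P_meas eq] by blast
  ultimately show "\<exists>F :: nat \<Rightarrow> complex ^ 'n \<Rightarrow> complex.
      (\<forall>n. F n \<in> bergman \<Omega> 2 \<and> (\<lambda>z. F n z - f z) \<in> Lp \<Omega> p) \<and>
      (\<lambda>n. Lp_norm \<Omega> p (\<lambda>z. F n z - f z)) \<longlonglongrightarrow> 0"
    by (intro exI[of _ "\<lambda>n. P (t n)"]) blast
qed

end
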